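(* Let $A$ and $B$ be two measured sets. Then $\sharp A\le \sharp B$ if and only if there is an injection from $A$ into $B$.
   Context: We work in Sergeyev's numeral system, which contains the standard numerals for finite integers together with the symbol ① (grossone), defined as the number of elements of the set of natural numbers, with $n<$ ① for every finite positive integer $n$. Postulate 3 of this system: "the part is less than the whole" holds for all numbers and all sets, so a proper subset of a set has strictly fewer elements. For a number $\mu$, $[1..\mu]$ denotes the set of integers $k$ with $1\le k\le\mu$. A measurement of a nonempty set $E$ in a numeral system $\mathcal S$ is a (described) bijection from $[1..\mu]$ onto $E$, where $\mu$ is a positive integer (finite or infinite, possibly larger than ①) expressible in $\mathcal S$; $E$ is then measured and $\sharp E=\mu$.
   Formalization: Postulate 3 over all sets and maps contradicts infinite integers (k→k+1 for finite k, identity otherwise, maps [1..①] onto a proper part), so sets, bijections and injections are taken in a universe closed under inclusion, composition, inverses of bijections and images. *)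

theory Defs
  imports "HOL-Library.FuncSet" "HOL-Computational_Algebra.Polynomial"
begin

text \<open>
  In HOL, an infinite initial segment of the integers is in bijection with a proper subset of
  itself, so ``the part is less than the whole'' is inconsistent with infinite integers if it ranges
  over all HOL sets and functions.  It is therefore stated for a universe of sets and maps that is
  given along with the numbers and is closed under the elementary operations on maps (as, for
  instance, the internal sets and maps of nonstandard analysis are).  All sets and maps of the
  theory, the injections included, belong to this universe.

  The type \<open>'n\<close> is that of the (finite and infinite) integers, \<open>'u\<close> that of the possible elements of
  sets; \<open>num\<close> makes the integers such elements.  A map from \<open>A\<close> to \<open>B\<close> is a function that is
  \<^const>\<open>undefined\<close> outside \<open>A\<close>.  Sets and maps make up the universe; the integers expressible in the
  numeral system and the maps describable in it are separate data.
\<close>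

record ('n, 'u) gross_system =
  num :: "'n \<Rightarrow> 'u"
  grossone :: 'n
  Sets :: "'u set set"
  Maps :: "'u set \<Rightarrow> 'u set \<Rightarrow> ('u \<Rightarrow> 'u) set"
  expressible :: "'n set"
  described :: "'u set \<Rightarrow> 'u set \<Rightarrow> ('u \<Rightarrow> 'u) set"

definition segment :: "('n::linordered_idom, 'u) gross_system \<Rightarrow> 'n \<Rightarrow> 'u set" where
  "segment S \<mu> = num S ` {1..\<mu>}"

definition has_number :: "('n::linordered_idom, 'u) gross_system \<Rightarrow> 'u set \<Rightarrow> 'n \<Rightarrow> bool" where
  "has_number S E \<mu> \<longleftrightarrow> 0 \<le> \<mu> \<and> (\<exists>f\<in>Maps S (segment S \<mu>) E. bij_betw f (segment S \<mu>) E)"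

text \<open>
  The set of natural numbers is \<open>[1..grossone]\<close>; that \<^term>\<open>grossone\<close> is its number of elements is the
  lemma \<open>count_naturals\<close> below.
\<close>

definition naturals :: "('n::linordered_idom, 'u) gross_system \<Rightarrow> 'u set" where
  "naturals S = segment S (grossone S)"

locale gross_numeral_system =
  fixes S :: "('n::linordered_idom, 'u) gross_system"
  assumes discrete: "\<And>k::'n. 0 < k \<Longrightarrow> 1 \<le> k"
    and inj_num: "inj (num S)"
    and finite_less_grossone: "\<And>n. of_nat n < grossone S"
    and segment_Sets: "\<And>\<mu>. segment S \<mu> \<in> Sets S"
    and Maps_Sets: "\<And>A B f. f \<in> Maps S A B \<Longrightarrow> A \<in> Sets S \<and> B \<in> Sets S"
    and Maps_PiE: "\<And>A B. Maps S A B \<subseteq> A \<rightarrow>\<^sub>E B"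
    and inclusion_Maps: "\<And>A B. \<lbrakk>A \<in> Sets S; B \<in> Sets S; A \<subseteq> B\<rbrakk> \<Longrightarrow> (\<lambda>x\<in>A. x) \<in> Maps S A B"
    and compose_Maps: "\<And>A B C f g. \<lbrakk>f \<in> Maps S A B; g \<in> Maps S B C\<rbrakk> \<Longrightarrow> compose A g f \<in> Maps S A C"
    and inverse_Maps: "\<And>A B f. \<lbrakk>f \<in> Maps S A B; bij_betw f A B\<rbrakk> \<Longrightarrow> (\<lambda>y\<in>B. inv_into A f y) \<in> Maps S B A"
    and image_Maps: "\<And>A B f. f \<in> Maps S A B \<Longrightarrow> f \<in> Maps S A (f ` A)"
    and part_less_whole:
      "\<And>A B \<mu> \<nu>. \<lbrakk>A \<subset> B; has_number S A \<mu>; has_number S B \<nu>\<rbrakk> \<Longrightarrow> \<mu> < \<nu>"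
    and finite_expressible: "\<And>z. of_int z \<in> expressible S"
    and grossone_expressible: "grossone S \<in> expressible S"
    and described_Maps: "\<And>A B. described S A B \<subseteq> Maps S A B"
    and identity_described:
      "\<And>\<mu>. \<mu> \<in> expressible S \<Longrightarrow> (\<lambda>x\<in>segment S \<mu>. x) \<in> described S (segment S \<mu>) (segment S \<mu>)"

definition measurement ::
  "('n::linordered_idom, 'u) gross_system \<Rightarrow> 'u set \<Rightarrow> 'n \<Rightarrow> ('u \<Rightarrow> 'u) \<Rightarrow> bool" where
  "measurement S E \<mu> f \<longleftrightarrow> E \<noteq> {} \<and> 0 < \<mu> \<and> \<mu> \<in> expressible S \<and>
     f \<in> described S (segment S \<mu>) E \<and> bij_betw f (segment S \<mu>) E"

definition measured :: "('n::linordered_idom, 'u) gross_system \<Rightarrow> 'u set \<Rightarrow> bool" where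
  "measured S E \<longleftrightarrow> (\<exists>\<mu> f. measurement S E \<mu> f)"

text \<open>Meaningful for measured \<open>E\<close> only; see \<open>measurement_unique\<close> below.\<close>

definition count :: "('n::linordered_idom, 'u) gross_system \<Rightarrow> 'u set \<Rightarrow> 'n"
    (\<open>\<sharp>\<^bsub>_\<^esub> _\<close> [0, 90] 90) where
  "\<sharp>\<^bsub>S\<^esub> E = (THE \<mu>. \<exists>f. measurement S E \<mu> f)"

context gross_numeral_system
begin

lemma measurement_has_number: "measurement S E \<mu> f \<Longrightarrow> has_number S E \<mu>"
  using described_Maps unfolding measurement_def has_number_def by (meson less_imp_le subsetD)

lemma has_number_unique:
  assumes "has_number S E \<mu>" "has_number S E \<nu>"
  shows "\<mu> = \<nu>"
proof -
  have "\<not> \<mu> < \<nu>" if E: "has_number S E \<mu>" "has_number S E \<nu>" for \<mu> \<nu>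
  proof
    assume less: "\<mu> < \<nu>"
    from E obtain f g where
      f: "0 \<le> \<mu>" "f \<in> Maps S (segment S \<mu>) E" "bij_betw f (segment S \<mu>) E" and
      g: "0 \<le> \<nu>" "g \<in> Maps S (segment S \<nu>) E" "bij_betw g (segment S \<nu>) E"
      unfolding has_number_def by blast
    let ?g' = "\<lambda>y\<in>E. inv_into (segment S \<nu>) g y"
    have g': "?g' \<in> Maps S E (segment S \<nu>)" using inverse_Maps g by blast
    have "bij_betw (compose (segment S \<mu>) ?g' f) (segment S \<mu>) (segment S \<nu>)"
    proof (rule bij_betw_compose[OF f(3)])
      show "bij_betw ?g' E (segment S \<nu>)"
        using bij_betw_inv_into[OF g(3)] by (subst bij_betw_cong[where g = "inv_into (segment S \<nu>) g"]) simp_all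
    qed
    then have "has_number S (segment S \<nu>) \<mu>"
      unfolding has_number_def using f(1) compose_Maps[OF f(2) g'] by blast
    moreover have "has_number S (segment S \<mu>) \<mu>"
      unfolding has_number_def using f(1) inclusion_Maps[OF segment_Sets segment_Sets subset_refl]
      by (intro conjI bexI[where x = "\<lambda>x\<in>segment S \<mu>. x"]) (auto simp: bij_betw_def inj_on_def)
    moreover have "segment S \<mu> \<subset> segment S \<nu>"
    proof
      show "segment S \<mu> \<subseteq> segment S \<nu>" using less unfolding segment_def by auto
      have "0 < \<nu>" using f(1) less by simp
      then have "num S \<nu> \<in> segment S \<nu>" using discrete unfolding segment_def by auto
      moreover have "num S \<nu> \<notin> segment S \<mu>"
        using less inj_num unfolding segment_def by (auto simp: inj_eq)
      ultimately show "segment S \<mu> \<noteq> segment S \<nu>" by auto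
    qed
    ultimately show False using part_less_whole by blast
  qed
  then show ?thesis using assms by (meson linorder_cases)
qed

lemma measurement_unique:
  "\<lbrakk>measurement S E \<mu> f; measurement S E \<nu> g\<rbrakk> \<Longrightarrow> \<mu> = \<nu>"
  using has_number_unique measurement_has_number by blast

lemma count_eqI: "measurement S E \<mu> f \<Longrightarrow> \<sharp>\<^bsub>S\<^esub> E = \<mu>"
  unfolding count_def using measurement_unique by blast

lemma count_segment:
  assumes "0 < \<mu>" "\<mu> \<in> expressible S"
  shows "\<sharp>\<^bsub>S\<^esub> (segment S \<mu>) = \<mu>"
proof (rule count_eqI)
  have "segment S \<mu> \<noteq> {}" using discrete[OF assms(1)] unfolding segment_def by auto
  then show "measurement S (segment S \<mu>) \<mu> (\<lambda>x\<in>segment S \<mu>. x)"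
    unfolding measurement_def using assms identity_described
    by (auto simp: bij_betw_def inj_on_def)
qed

lemma count_naturals: "\<sharp>\<^bsub>S\<^esub> (naturals S) = grossone S"
  unfolding naturals_def using count_segment grossone_expressible finite_less_grossone[of 0] by simp

end

text \<open>
  The axioms are satisfiable: take integer polynomials as numbers (ordered by the leading
  coefficient of the difference), the indeterminate as \<^term>\<open>grossone\<close>, intervals as sets and
  translations as maps.
\<close>

definition poly_system :: "(int poly, int poly) gross_system" where
  "poly_system = \<lparr>
     num = (\<lambda>x. x),
     grossone = [:0, 1:],
     Sets = {{a..b} | a b. True},
     Maps = (\<lambda>A B. {(\<lambda>x\<in>A. x + c) | c. A \<in> {{a..b} | a b. True} \<and> B \<in> {{a..b} | a b. True} \<and>
       (\<lambda>x. x + c) ` A \<subseteq> B}),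
     expressible = UNIV,
     described = (\<lambda>A B. {(\<lambda>x\<in>A. x + c) | c. A \<in> {{a..b} | a b. True} \<and> B \<in> {{a..b} | a b. True} \<and>
       (\<lambda>x. x + c) ` A \<subseteq> B})\<rparr>"

lemma poly_Maps_iff:
  "f \<in> Maps poly_system A B \<longleftrightarrow> A \<in> Sets poly_system \<and> B \<in> Sets poly_system \<and>
     (\<exists>c. f = (\<lambda>x\<in>A. x + c) \<and> (\<lambda>x. x + c) ` A \<subseteq> B)"
  unfolding poly_system_def by auto

lemma poly_discrete: "(0::int poly) < p \<Longrightarrow> 1 \<le> p"
proof -
  assume "0 < p"
  then have p: "0 < lead_coeff p" by (simp add: less_poly_def pos_poly_def)
  show "1 \<le> p"
  proof (cases "degree p = 0")
    case True
    then obtain a where "p = [:a:]" by (rule degree_eq_zeroE)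
    with p show ?thesis
      by (cases "a = 1") (auto simp: less_eq_poly_def pos_poly_def one_pCons)
  next
    case False
    then have "degree (p - 1) = degree p" "coeff (p - 1) (degree p) = lead_coeff p"
      using degree_add_eq_left[of "- 1" p] by (auto simp: coeff_eq_0)
    with p show ?thesis by (simp add: less_eq_poly_def pos_poly_def)
  qed
qed

lemma poly_has_number:
  assumes "has_number poly_system A \<mu>"
  shows "\<exists>c. A = {1 + c..\<mu> + c}" "0 \<le> \<mu>"
proof -
  obtain f c where "bij_betw f {1..\<mu>} A" "f = (\<lambda>x\<in>{1..\<mu>}. x + c)"
    using assms unfolding has_number_def poly_Maps_iff by (auto simp: segment_def poly_system_def)
  then have "A = (\<lambda>x. x + c) ` {1..\<mu>}" by (auto simp: bij_betw_def)
  then show "\<exists>c. A = {1 + c..\<mu> + c}" by auto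
  show "0 \<le> \<mu>" using assms by (simp add: has_number_def)
qed

lemma gross_numeral_system_poly: "gross_numeral_system poly_system"
proof
  fix \<mu> :: "int poly" and n :: nat
  show "0 < \<mu> \<Longrightarrow> 1 \<le> \<mu>" by (rule poly_discrete)
  show "inj (num poly_system)" by (simp add: poly_system_def)
  show "of_nat n < grossone poly_system"
    by (simp add: poly_system_def less_poly_def pos_poly_def of_nat_poly)
  show seg: "segment poly_system \<mu> \<in> Sets poly_system"
    by (auto simp: segment_def poly_system_def)
  show "of_int z \<in> expressible poly_system" for z by (simp add: poly_system_def)
  show "grossone poly_system \<in> expressible poly_system" by (simp add: poly_system_def)
  show "described poly_system A B \<subseteq> Maps poly_system A B" for A B by (simp add: poly_system_def)
next
  fix A B C :: "int poly set" and f g :: "int poly \<Rightarrow> int poly"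
  show incl: "(\<lambda>x\<in>A. x) \<in> Maps poly_system A B"
    if "A \<in> Sets poly_system" "B \<in> Sets poly_system" "A \<subseteq> B" for A B
    using that unfolding poly_Maps_iff by (auto intro!: exI[of _ 0])
  show "(\<lambda>x\<in>segment poly_system \<mu>. x) \<in> described poly_system (segment poly_system \<mu>) (segment poly_system \<mu>)"
    for \<mu>
  proof -
    have "described poly_system = Maps poly_system" by (simp add: poly_system_def)
    moreover have "segment poly_system \<mu> \<in> Sets poly_system"
      by (auto simp: segment_def poly_system_def)
    ultimately show ?thesis using incl by simp
  qed
  show "Maps poly_system A B \<subseteq> A \<rightarrow>\<^sub>E B" unfolding subset_iff poly_Maps_iff by auto
  assume f: "f \<in> Maps poly_system A B"
  then obtain c where AB: "A \<in> Sets poly_system" "B \<in> Sets poly_system"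
    and c: "f = (\<lambda>x\<in>A. x + c)" "(\<lambda>x. x + c) ` A \<subseteq> B"
    unfolding poly_Maps_iff by blast
  show "A \<in> Sets poly_system \<and> B \<in> Sets poly_system" using AB by simp
  have im: "f ` A = (\<lambda>x. x + c) ` A" using c(1) by auto
  obtain a b where A: "A = {a..b}" using AB by (auto simp: poly_system_def)
  have "f ` A = {a + c..b + c}" using im A by auto
  then have "f ` A \<in> Sets poly_system" by (auto simp: poly_system_def)
  then show "f \<in> Maps poly_system A (f ` A)"
    unfolding poly_Maps_iff using AB c(1) im by blast
  {
    assume "g \<in> Maps poly_system B C"
    then obtain d where BC: "C \<in> Sets poly_system"
      and d: "g = (\<lambda>x\<in>B. x + d)" "(\<lambda>x. x + d) ` B \<subseteq> C"
      unfolding poly_Maps_iff by blast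
    have "compose A g f = (\<lambda>x\<in>A. x + (c + d))"
      using c d by (auto simp: compose_def fun_eq_iff algebra_simps restrict_def)
    moreover have "(\<lambda>x. x + (c + d)) ` A \<subseteq> C"
    proof
      fix y assume "y \<in> (\<lambda>x. x + (c + d)) ` A"
      then obtain x where "x \<in> A" "y = (x + c) + d" by (auto simp: algebra_simps)
      then show "y \<in> C" using c(2) d(2) by blast
    qed
    ultimately show "compose A g f \<in> Maps poly_system A C"
      unfolding poly_Maps_iff using AB(1) BC by blast
  }
  {
    assume bij: "bij_betw f A B"
    have "inv_into A f y = y + - c" if y: "y \<in> B" for y
    proof -
      obtain x where x: "x \<in> A" "y = f x" using y bij by (auto simp: bij_betw_def)
      then have "inv_into A f y = x" using inv_into_f_f[OF bij_betw_imp_inj_on[OF bij]] by metis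
      moreover have "y = x + c" using x unfolding c(1) by simp
      ultimately show ?thesis by simp
    qed
    then have eq: "(\<lambda>y\<in>B. inv_into A f y) = (\<lambda>y\<in>B. y + - c)" by auto
    have "B = (\<lambda>x. x + c) ` A" using bij im by (simp add: bij_betw_def)
    then have "(\<lambda>y. y + - c) ` B \<subseteq> A" by auto
    then show "(\<lambda>y\<in>B. inv_into A f y) \<in> Maps poly_system B A"
      unfolding poly_Maps_iff using AB eq by blast
  }
next
  fix A B :: "int poly set" and \<mu> \<nu> :: "int poly"
  assume sub: "A \<subset> B" and "has_number poly_system A \<mu>" "has_number poly_system B \<nu>"
  obtain c where A: "A = {1 + c..\<mu> + c}" "0 \<le> \<mu>"
    using poly_has_number[OF \<open>has_number poly_system A \<mu>\<close>] by blast
  obtain d where B: "B = {1 + d..\<nu> + d}" "0 \<le> \<nu>"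
    using poly_has_number[OF \<open>has_number poly_system B \<nu>\<close>] by blast
  show "\<mu> < \<nu>"
  proof (rule ccontr)
    assume "\<not> \<mu> < \<nu>"
    then have le: "\<nu> \<le> \<mu>" by (simp add: not_less)
    have "\<nu> \<noteq> 0"
    proof
      assume "\<nu> = 0"
      then have "B = {}" using B(1) by simp
      then show False using sub by blast
    qed
    then have "0 < \<mu>" using le B(2) by order
    then have "1 + c \<le> \<mu> + c" using poly_discrete add_right_mono by blast
    then have le': "1 + d \<le> 1 + c" "\<mu> + c \<le> \<nu> + d"
      using psubset_imp_subset[OF sub] unfolding A(1) B(1) by (simp_all only: atLeastatMost_subset_iff) blast+
    have "\<nu> + d \<le> \<mu> + d" using le by (rule add_right_mono)
    with le'(2) have "\<mu> + c \<le> \<mu> + d" by (rule order_trans)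
    then have "c \<le> d" by (rule add_le_imp_le_left)
    moreover have "d \<le> c" using le'(1) by (rule add_le_imp_le_left)
    ultimately have "c = d" by (rule antisym)
    moreover from le'(2) have "\<mu> \<le> \<nu>" unfolding \<open>c = d\<close> by (rule add_le_imp_le_right)
    then have "\<mu> = \<nu>" using le by (rule antisym)
    ultimately show False using sub A(1) B(1) by blast
  qed
qed

end

theory Submission
  imports Defs
begin

text \<open>
  An inequality of the counts is an inclusion of the segments that measure the two sets, and
  transporting this inclusion along the measurements gives the injection.  Conversely, an injection
  identifies \<open>A\<close> with a part of \<open>B\<close> that has as many elements as \<open>A\<close>, and the part is not greater
  than the whole.
\<close>

context gross_numeral_system
begin

text \<open>The axiom \<open>part_less_whole\<close> speaks of proper parts only; for
  \<open>A = B\<close> the inequality comes from the uniqueness of the number.\<close>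

lemma has_number_mono:
  assumes "A \<subseteq> B" "has_number S A \<mu>" "has_number S B \<nu>"
  shows "\<mu> \<le> \<nu>"
proof (cases "A = B")
  case True
  then show ?thesis using assms has_number_unique by blast
next
  case False
  then have "A \<subset> B" using assms(1) by blast
  then show ?thesis using assms part_less_whole less_imp_le by blast
qed

lemma has_number_image:
  assumes "has_number S A \<mu>" "h \<in> Maps S A B" "inj_on h A"
  shows "has_number S (h ` A) \<mu>"
proof -
  obtain f where f: "0 \<le> \<mu>" "f \<in> Maps S (segment S \<mu>) A" "bij_betw f (segment S \<mu>) A"
    using assms(1) unfolding has_number_def by blast
  \<comment> \<open>Shrinking the codomain of \<open>h\<close> to its image turns the injection into
    a bijection that still belongs to the universe.\<close>
  have "compose (segment S \<mu>) h f \<in> Maps S (segment S \<mu>) (h ` A)"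
    using f(2) image_Maps[OF assms(2)] by (rule compose_Maps)
  moreover have "bij_betw (compose (segment S \<mu>) h f) (segment S \<mu>) (h ` A)"
    using f(3) inj_on_imp_bij_betw[OF assms(3)] by (rule bij_betw_compose)
  ultimately show ?thesis using f(1) unfolding has_number_def by blast
qed

lemma has_number_le_imp_injection:
  assumes "has_number S A \<mu>" "has_number S B \<nu>" "\<mu> \<le> \<nu>"
  shows "\<exists>h\<in>Maps S A B. inj_on h A"
proof -
  obtain f where f: "f \<in> Maps S (segment S \<mu>) A" "bij_betw f (segment S \<mu>) A"
    using assms(1) unfolding has_number_def by blast
  obtain g where g: "g \<in> Maps S (segment S \<nu>) B" "bij_betw g (segment S \<nu>) B"
    using assms(2) unfolding has_number_def by blast
  let ?f' = "\<lambda>y\<in>A. inv_into (segment S \<mu>) f y"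
  \<comment> \<open>\<open>compose_Maps\<close> needs matching domains, so \<open>g\<close> is
    restricted to the shorter segment by composing it with the inclusion.\<close>
  let ?i = "\<lambda>x\<in>segment S \<mu>. x"
  let ?h = "compose A (compose (segment S \<mu>) g ?i) ?f'"
  have sub: "segment S \<mu> \<subseteq> segment S \<nu>" using assms(3) unfolding segment_def by auto
  then have "?i \<in> Maps S (segment S \<mu>) (segment S \<nu>)"
    using inclusion_Maps segment_Sets by blast
  then have "?h \<in> Maps S A B"
    using compose_Maps inverse_Maps f g(1) by blast
  moreover have "inj_on ?h A"
  proof (rule inj_onI)
    fix x y assume x: "x \<in> A" and y: "y \<in> A" and eq: "?h x = ?h y"
    have f': "bij_betw (inv_into (segment S \<mu>) f) A (segment S \<mu>)"
      using f(2) by (rule bij_betw_inv_into)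
    note mem = bij_betwE[OF f', rule_format]
    \<comment> \<open>By \<open>mem\<close> the inverse values lie in the segment of \<mu>, where
      the restricted maps take their proper values and not \<open>undefined\<close>.\<close>
    have "g (inv_into (segment S \<mu>) f x) = g (inv_into (segment S \<mu>) f y)"
      using eq x y mem by (simp add: compose_def)
    then have "inv_into (segment S \<mu>) f x = inv_into (segment S \<mu>) f y"
      using inj_onD[OF bij_betw_imp_inj_on[OF g(2)]] mem[OF x] mem[OF y] sub by blast
    then show "x = y" using inj_onD[OF bij_betw_imp_inj_on[OF f']] x y by blast
  qed
  ultimately show ?thesis by blast
qed

end

theorem theorem3:
  fixes S :: "('n::linordered_idom, 'u) gross_system" and A B :: "'u set"
  assumes "gross_numeral_system S"
    and "measured S A" and "measured S B"
  shows "\<sharp>\<^bsub>S\<^esub> A \<le> \<sharp>\<^bsub>S\<^esub> B \<longleftrightarrow> (\<exists>h\<in>Maps S A B. inj_on h A)"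
proof -
  interpret gross_numeral_system S by (rule assms(1))
  \<comment> \<open>For a measured set the definite description denotes an actual number, and the
    rest of the argument takes place in \<open>Maps\<close>.\<close>
  have count: "has_number S E (\<sharp>\<^bsub>S\<^esub> E)" if "measured S E" for E
    using that count_eqI measurement_has_number unfolding measured_def by blast
  note A = count[OF assms(2)] and B = count[OF assms(3)]
  show ?thesis
  proof
    assume "\<sharp>\<^bsub>S\<^esub> A \<le> \<sharp>\<^bsub>S\<^esub> B"
    with A B show "\<exists>h\<in>Maps S A B. inj_on h A" by (rule has_number_le_imp_injection)
  next
    assume "\<exists>h\<in>Maps S A B. inj_on h A"
    then obtain h where h: "h \<in> Maps S A B" "inj_on h A" by blast
    have "h ` A \<subseteq> B" using h(1) Maps_PiE by blast
    then show "\<sharp>\<^bsub>S\<^esub> A \<le> \<sharp>\<^bsub>S\<^esub> B" using has_number_image[OF A h] B by (rule has_number_mono)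
  qed
qed

end
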